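(* For $n\ge 1$ let $a_n = |S_n^2(132,213)|$. Then $a_1=1$ and $a_{n+1} = a_n + 3\cdot 2^{n-1} + 2(n-1)$ for all $n\ge 1$.
   Context: A $3$-permutation of size $n$ is an ordered pair $(\sigma,\sigma')$ of permutations of $[n]=\{1,\dots,n\}$. A (classical) permutation $\tau\in S_n$ contains a pattern $\pi\in S_k$ if there are indices $c_1<\dots<c_k$ such that $\tau(c_1)\cdots\tau(c_k)$ is order-isomorphic to $\pi$, and avoids $\pi$ otherwise. A $3$-permutation $(\sigma,\sigma')$ avoids a pattern $\pi\in S_k$ if each of the three permutations $\sigma$, $\sigma'$, and $\sigma'\circ\sigma^{-1}$ (where $(\sigma'\circ\sigma^{-1})(i)=\sigma'(\sigma^{-1}(i))$) avoids $\pi$. $S_n^2(\pi_1,\dots,\pi_m)$ denotes the set of $3$-permutations of size $n$ avoiding each of $\pi_1,\dots,\pi_m$. Patterns are written in one-line notation. *)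

theory Defs
  imports Main "HOL-Combinatorics.Permutations"
begin

(* S_n is the set of functions t :: nat => nat with "t permutes {1..n}".
   A pattern in S_k is the list of its k values in one-line notation, so "p ! i" is its
   value at i + 1, and c below is indexed from 0 accordingly. *)

definition contains_pattern :: "nat \<Rightarrow> (nat \<Rightarrow> nat) \<Rightarrow> nat list \<Rightarrow> bool" where
  "contains_pattern n t p \<longleftrightarrow>
     (\<exists>c :: nat \<Rightarrow> nat. strict_mono_on {..<length p} c \<and> c ` {..<length p} \<subseteq> {1..n} \<and>
        (\<forall>i<length p. \<forall>j<length p. t (c i) < t (c j) \<longleftrightarrow> p ! i < p ! j))"

definition avoids_pattern :: "nat \<Rightarrow> (nat \<Rightarrow> nat) \<Rightarrow> nat list \<Rightarrow> bool" where
  "avoids_pattern n t p \<longleftrightarrow> \<not> contains_pattern n t p"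

definition three_permutations :: "nat \<Rightarrow> ((nat \<Rightarrow> nat) \<times> (nat \<Rightarrow> nat)) set" where
  "three_permutations n = {(s, s'). s permutes {1..n} \<and> s' permutes {1..n}}"

fun avoids_pattern3 :: "nat \<Rightarrow> (nat \<Rightarrow> nat) \<times> (nat \<Rightarrow> nat) \<Rightarrow> nat list \<Rightarrow> bool" where
  "avoids_pattern3 n (s, s') p \<longleftrightarrow>
     avoids_pattern n s p \<and> avoids_pattern n s' p \<and> avoids_pattern n (s' \<circ> inv s) p"

definition avoiding_three_permutations ::
    "nat \<Rightarrow> nat list set \<Rightarrow> ((nat \<Rightarrow> nat) \<times> (nat \<Rightarrow> nat)) set" where
  "avoiding_three_permutations n P =
     {x \<in> three_permutations n. \<forall>p\<in>P. avoids_pattern3 n x p}"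

end

theory Submission
  imports Defs
begin

text \<open>
  A permutation avoids 132 and 213 iff it is a decreasing sequence of blocks of consecutive
  increasing values, that is, iff \<open>t j - t i = j - i\<close> for every non-inversion \<open>i < j\<close>. This class
  is closed under inverses and has \<open>2 ^ (n - 1)\<close> members. The crucial point is that if \<open>s\<close>, \<open>t\<close> and
  \<open>t \<circ> s\<close> all lie in the class and none is the identity, then each of them has exactly two blocks, so is
  a rotation of \<open>{1..n}\<close>; a third block would force a 132 or a 213 in \<open>t \<circ> s\<close>.
  Pairs in which \<open>s\<close>, \<open>s'\<close> or \<open>s' \<circ> inv s\<close> is the identity number \<open>3 * 2 ^ (n - 1) - 2\<close>, and the pairs of
  distinct nontrivial rotations contribute the remaining \<open>(n - 1) * (n - 2)\<close>.
\<close>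

section \<open>From pattern avoidance to the slope-one condition on non-inversions\<close>

definition reverse_layered :: "nat \<Rightarrow> (nat \<Rightarrow> nat) set" where
  "reverse_layered n = {t. t permutes {1..n} \<and>
     (\<forall>i\<in>{1..n}. \<forall>j\<in>{1..n}. i < j \<longrightarrow> t i < t j \<longrightarrow> t j + i = t i + j)}"

lemma contains_pattern_3:
  "contains_pattern n t [p, q, r] \<longleftrightarrow>
     (\<exists>i j k. 1 \<le> i \<and> i < j \<and> j < k \<and> k \<le> n \<and>
        (t i < t j \<longleftrightarrow> p < q) \<and> (t j < t i \<longleftrightarrow> q < p) \<and>
        (t i < t k \<longleftrightarrow> p < r) \<and> (t k < t i \<longleftrightarrow> r < p) \<and>
        (t j < t k \<longleftrightarrow> q < r) \<and> (t k < t j \<longleftrightarrow> r < q))" (is "_ = ?R")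
proof
  have l: "{..<length [p, q, r]} = {0, 1, 2}" by auto
  have all3: "(\<forall>i<length [p, q, r]. P i) \<longleftrightarrow> P 0 \<and> P 1 \<and> P 2" for P
    by (auto simp: less_Suc_eq numeral_2_eq_2)
  {
    assume "contains_pattern n t [p, q, r]"
    then obtain c where "strict_mono_on {0, 1, 2} c" "c ` {0, 1, 2} \<subseteq> {1..n}"
      and c: "\<forall>i<length [p, q, r]. \<forall>j<length [p, q, r].
                t (c i) < t (c j) \<longleftrightarrow> [p, q, r] ! i < [p, q, r] ! j"
      unfolding contains_pattern_def l by blast
    then have "1 \<le> c 0" "c 0 < c 1" "c 1 < c 2" "c 2 \<le> n"
      by (auto simp: strict_mono_on_def)
    with c[unfolded all3] show ?R
      by (intro exI[of _ "c 0"] exI[of _ "c 1"] exI[of _ "c 2"]) simp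
  next
    assume ?R
    then obtain i j k where *: "1 \<le> i" "i < j" "j < k" "k \<le> n"
        "t i < t j \<longleftrightarrow> p < q" "t j < t i \<longleftrightarrow> q < p"
        "t i < t k \<longleftrightarrow> p < r" "t k < t i \<longleftrightarrow> r < p"
        "t j < t k \<longleftrightarrow> q < r" "t k < t j \<longleftrightarrow> r < q"
      by blast
    show "contains_pattern n t [p, q, r]"
      unfolding contains_pattern_def all3 l
      by (rule exI[of _ "\<lambda>m. [i, j, k] ! m"]) (use * in \<open>auto simp: strict_mono_on_def\<close>)
  }
qed

lemma contains_132:
  "contains_pattern n t [1, 3, 2] \<longleftrightarrow>
     (\<exists>i j k. 1 \<le> i \<and> i < j \<and> j < k \<and> k \<le> n \<and> t i < t k \<and> t k < t j)"
  unfolding contains_pattern_3 by (intro iff_exI) auto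

lemma contains_213:
  "contains_pattern n t [2, 1, 3] \<longleftrightarrow>
     (\<exists>i j k. 1 \<le> i \<and> i < j \<and> j < k \<and> k \<le> n \<and> t j < t i \<and> t i < t k)"
  unfolding contains_pattern_3 by (intro iff_exI) auto

lemma reverse_layeredD:
  assumes "t \<in> reverse_layered n"
  shows "t permutes {1..n}"
    and "1 \<le> i \<Longrightarrow> i < j \<Longrightarrow> j \<le> n \<Longrightarrow> t i < t j \<Longrightarrow> t j + i = t i + j"
  using assms by (auto simp: reverse_layered_def)

text \<open>A non-inversion has both ends in one layer, and a layer is an interval of positions. If
  \<open>t j\<close> were below \<open>t i\<close>, then \<open>j\<close>, \<open>k\<close> would be
  a non-inversion of slope one too, and \<open>k - j < k - i\<close> would put \<open>t j\<close>
  above \<open>t i\<close>.\<close>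

lemma reverse_layered_between:
  assumes "t \<in> reverse_layered n" "1 \<le> i" "i < j" "j < k" "k \<le> n" "t i < t k"
  shows "t i < t j" "t j < t k"
proof -
  note d = reverse_layeredD(2)[OF assms(1)]
  have ik: "t k + i = t i + k" using d[of i k] assms by simp
  have "t i \<noteq> t j"
    using permutes_inj[OF reverse_layeredD(1)[OF assms(1)]] assms by (auto dest: injD)
  show "t i < t j"
  proof (rule ccontr)
    assume "\<not> t i < t j"
    then show False using \<open>t i \<noteq> t j\<close> d[of j k] ik assms by simp
  qed
  then show "t j < t k" using d[of i j] ik assms by simp
qed

lemma avoids_iff_reverse_layered:
  assumes "t permutes {1..n}"
  shows "avoids_pattern n t [1, 3, 2] \<and> avoids_pattern n t [2, 1, 3] \<longleftrightarrow> t \<in> reverse_layered n"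
proof
  assume "avoids_pattern n t [1, 3, 2] \<and> avoids_pattern n t [2, 1, 3]"
  then have a: "\<not> (t i < t k \<and> t k < t j)" and b: "\<not> (t j < t i \<and> t i < t k)"
    if "1 \<le> i" "i < j" "j < k" "k \<le> n" for i j k
    using that unfolding avoids_pattern_def contains_132 contains_213 by blast+
  have "t k + i = t i + k" if ik: "1 \<le> i" "i < k" "k \<le> n" "t i < t k" for i k
  proof -
    have inj: "inj t" using assms by (rule permutes_inj)
    \<comment> \<open>A position between \<open>i\<close> and \<open>k\<close> with value outside
      the interval completes a 132 or a 213, and so does a position outside with value inside. Equal
      cardinalities of the two intervals then give slope one.\<close>
    have "t ` {i<..<k} = {t i<..<t k}"
    proof (intro equalityI subsetI)
      fix y assume "y \<in> t ` {i<..<k}"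
      then obtain j where j: "i < j" "j < k" "y = t j" by auto
      have "t j \<noteq> t i" "t j \<noteq> t k" using j inj by (auto dest: injD)
      then show "y \<in> {t i<..<t k}"
        using a[of i j k] b[of i j k] j ik by auto
    next
      fix y assume y: "y \<in> {t i<..<t k}"
      have "t i \<in> {1..n}" "t k \<in> {1..n}"
        using ik permutes_in_image[OF assms, of i] permutes_in_image[OF assms, of k] by auto
      then have "y \<in> {1..n}" using y by auto
      then obtain x where x: "x \<in> {1..n}" "y = t x"
        using permutes_image[OF assms] by blast
      have "x \<noteq> i" "x \<noteq> k" using x y by auto
      then show "y \<in> t ` {i<..<k}"
        using x y a[of i k x] b[of x i k] ik by fastforce
    qed
    then have "card {i<..<k} = card {t i<..<t k}"
      using card_image[of t "{i<..<k}"] inj by (metis inj_on_subset subset_UNIV)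
    then show ?thesis using ik by simp
  qed
  then show "t \<in> reverse_layered n" using assms by (auto simp: reverse_layered_def)
next
  assume t: "t \<in> reverse_layered n"
  \<comment> \<open>In each pattern two non-inversions share an entry; slope one on both makes the
    remaining pair increase, although the pattern has it decrease.\<close>
  have "\<not> (t i < t k \<and> t k < t j)" "\<not> (t j < t i \<and> t i < t k)"
    if "1 \<le> i" "i < j" "j < k" "k \<le> n" for i j k
    using that reverse_layeredD(2)[OF t, of i j] reverse_layeredD(2)[OF t, of i k]
      reverse_layeredD(2)[OF t, of j k] by auto
  then show "avoids_pattern n t [1, 3, 2] \<and> avoids_pattern n t [2, 1, 3]"
    unfolding avoids_pattern_def contains_132 contains_213 by blast
qed

lemma permutes_bounds:
  fixes n :: nat
  assumes "t permutes {1..n}" "1 \<le> i" "i \<le> n"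
  shows "1 \<le> t i" "t i \<le> n"
  using permutes_in_image[OF assms(1), of i] assms(2,3) by auto

lemma permutes_eqI:
  assumes "s permutes A" "t permutes A" "\<And>i. i \<in> A \<Longrightarrow> s i = t i"
  shows "s = t"
proof
  fix i show "s i = t i" using assms by (cases "i \<in> A") (auto simp: permutes_not_in)
qed

lemma id_reverse_layered: "id \<in> reverse_layered n"
  by (auto simp: reverse_layered_def permutes_id)

lemma inv_reverse_layered:
  assumes "t \<in> reverse_layered n"
  shows "inv t \<in> reverse_layered n"
proof -
  note p = reverse_layeredD(1)[OF assms]
  note q = permutes_inv[OF p]
  have "inv t j + i = inv t i + j" if "1 \<le> i" "i < j" "j \<le> n" "inv t i < inv t j" for i j
    using reverse_layeredD(2)[OF assms, of "inv t i" "inv t j"] permutes_inverses[OF p]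
      permutes_bounds[OF q, of i] permutes_bounds[OF q, of j] that by simp
  with q show ?thesis by (auto simp: reverse_layered_def)
qed

lemma finite_reverse_layered: "finite (reverse_layered n)"
  by (rule finite_subset[OF _ finite_permutations[of "{1..n}"]]) (auto simp: reverse_layered_def)

section \<open>Triples of reverse layered permutations\<close>

text \<open>Otherwise positions 1 and \<open>n\<close> share a layer, so there is only one layer:
  slope one over distance \<open>n - 1\<close> forces \<open>t 1 = 1\<close> and
  \<open>t n = n\<close>, and then comparison with position 1 fixes every \<open>i\<close>.\<close>

lemma reverse_layered_last_less_first:
  assumes "t \<in> reverse_layered n" "t \<noteq> id" "1 \<le> n"
  shows "t n < t 1"
proof (rule ccontr)
  assume "\<not> t n < t 1"
  note p = reverse_layeredD(1)[OF assms(1)] and d = reverse_layeredD(2)[OF assms(1)]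
  have "t i = id i" if i: "i \<in> {1..n}" for i
  proof -
    have le: "t 1 \<le> t n" using \<open>\<not> t n < t 1\<close> by simp
    have b: "1 \<le> t 1" "t n \<le> n" "1 \<le> t i" "t i \<le> n"
      using permutes_bounds[OF p] assms(3) i by auto
    have ends: "t 1 = 1 \<and> t n = n"
    proof (cases "n = 1")
      case False
      then have "t 1 \<noteq> t n" using permutes_inj[OF p] by (auto dest: injD)
      then show ?thesis using d[of 1 n] le b False assms(3) by auto
    qed (use b in auto)
    show ?thesis
    proof (cases "i = 1")
      case False
      then have "t i \<noteq> t 1" using permutes_inj[OF p] by (auto dest: injD)
      then show ?thesis using d[of 1 i] False i b ends by auto
    qed (use ends in auto)
  qed
  then have "t = id" using permutes_eqI[OF p permutes_id] by blast
  with assms(2) show False by simp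
qed

section \<open>Three or more layers, detected by the pattern 321\<close>

definition has_321 :: "nat \<Rightarrow> (nat \<Rightarrow> nat) \<Rightarrow> bool" where
  "has_321 n t \<longleftrightarrow> (\<exists>i j k. 1 \<le> i \<and> i < j \<and> j < k \<and> k \<le> n \<and> t k < t j \<and> t j < t i)"

text \<open>The outer entries of a 321 can be moved to positions 1 and \<open>n\<close>: if
  \<open>t 1 < t j\<close>, the position \<open>i\<close> in between would have
  \<open>t i < t j\<close>, and symmetrically at the other end.\<close>

lemma has_321_extremal:
  assumes "t \<in> reverse_layered n" "has_321 n t"
  obtains j where "1 < j" "j < n" "t n < t j" "t j < t 1"
proof -
  note p = reverse_layeredD(1)[OF assms(1)]
  obtain i j k where *: "1 \<le> i" "i < j" "j < k" "k \<le> n" "t k < t j" "t j < t i"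
    using assms(2) unfolding has_321_def by blast
  have "t j \<noteq> t 1" "t j \<noteq> t n"
    using * injD[OF permutes_inj[OF p], of j 1] injD[OF permutes_inj[OF p], of j n] by auto
  moreover have "\<not> t 1 < t j"
    using reverse_layered_between(2)[OF assms(1), of 1 i j] * by (cases "i = 1") auto
  moreover have "\<not> t j < t n"
    using reverse_layered_between(1)[OF assms(1), of j k n] * by (cases "k = n") auto
  ultimately show thesis using that[of j] * by auto
qed

text \<open>Exchanging positions and values turns a 321 into a 321.\<close>

lemma has_321_inv:
  assumes "t permutes {1..n}" "has_321 n t"
  shows "has_321 n (inv t)"
proof -
  obtain i j k where *: "1 \<le> i" "i < j" "j < k" "k \<le> n" "t k < t j" "t j < t i"
    using assms(2) unfolding has_321_def by blast
  then show ?thesis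
    unfolding has_321_def using permutes_bounds[OF assms(1)] permutes_inverses(2)[OF assms(1)]
    by (intro exI[of _ "t k"] exI[of _ "t j"] exI[of _ "t i"]) auto
qed

text \<open>As \<open>t \<circ> s\<close> is not the identity, it is lower at \<open>n\<close> than
  at 1. Hence \<open>s n < s 1\<close> is a non-inversion of \<open>t\<close>, so \<open>t\<close>
  increases along \<open>s n\<close>, \<open>s i\<close>, \<open>s 1\<close> and keeps the 321 of
  \<open>s\<close> at the same positions.\<close>

lemma has_321_comp:
  assumes "s \<in> reverse_layered n" "t \<in> reverse_layered n" "t \<circ> s \<in> reverse_layered n"
    and "t \<circ> s \<noteq> id" "has_321 n s"
  shows "has_321 n (t \<circ> s)"
proof -
  note p = reverse_layeredD(1)[OF assms(1)]
  obtain i where i: "1 < i" "i < n" "s n < s i" "s i < s 1"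
    using has_321_extremal[OF assms(1,5)] .
  have "t (s n) < t (s 1)"
    using reverse_layered_last_less_first[OF assms(3,4)] i by simp
  then have "t (s n) < t (s i)" "t (s i) < t (s 1)"
    using i reverse_layered_between[OF assms(2), of "s n" "s i" "s 1"]
      permutes_bounds[OF p, of 1] permutes_bounds[OF p, of n] by auto
  then show ?thesis using i unfolding has_321_def
    by (intro exI[of _ 1] exI[of _ i] exI[of _ n]) auto
qed

text \<open>
  The first factor maps the decreasing positions \<open>1 < i < n\<close> to values on which \<open>t\<close> increases. The
  block of \<open>t\<close> containing these values is its first, its last, or an inner one: the three cases below.
\<close>
lemma not_has_321:
  assumes s: "s \<in> reverse_layered n" and t: "t \<in> reverse_layered n"
    and ts: "t \<circ> s \<in> reverse_layered n"
    and ne: "s \<noteq> id" "t \<noteq> id" "t \<circ> s \<noteq> id"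
  shows "\<not> has_321 n s"
proof
  assume h: "has_321 n s"
  note ps = reverse_layeredD(1)[OF s] and ds = reverse_layeredD(2)[OF s]
  note pt = reverse_layeredD(1)[OF t]
  have "inv t = s \<circ> inv (t \<circ> s)"
    using permutes_inv_o[OF ps] permutes_inv_o[OF pt]
    by (simp add: o_inv_distrib permutes_bij[OF ps] permutes_bij[OF pt] o_assoc)
  \<comment> \<open>Applying \<open>has_321_comp\<close> twice around the relation between \<open>s\<close>, \<open>t\<close> and \<open>t \<circ> s\<close> transfers the pattern to \<open>t\<close>.\<close>
  have "has_321 n (s \<circ> inv (t \<circ> s))"
  proof (rule has_321_comp)
    show "inv (t \<circ> s) \<in> reverse_layered n" "s \<in> reverse_layered n"
      using s ts by (auto intro: inv_reverse_layered)
    show "s \<circ> inv (t \<circ> s) \<in> reverse_layered n" "s \<circ> inv (t \<circ> s) \<noteq> id"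
      using t ne(2) \<open>inv t = _\<close> inv_reverse_layered[OF t] inv_inv_eq[OF permutes_bij[OF pt]]
      by (metis inv_id)+
    show "has_321 n (inv (t \<circ> s))"
      using has_321_comp[OF s t ts ne(3) h] reverse_layeredD(1)[OF ts] by (rule has_321_inv[rotated])
  qed
  then have "has_321 n t"
    using has_321_inv[OF permutes_inv[OF pt]] \<open>inv t = _\<close> inv_inv_eq[OF permutes_bij[OF pt]] by metis
  then obtain j where j: "1 < j" "j < n" "t n < t j" "t j < t 1"
    using has_321_extremal[OF t] by blast
  obtain i where i: "1 < i" "i < n" "s n < s i" "s i < s 1"
    using has_321_extremal[OF s h] .
  have bs: "1 \<le> s 1" "s 1 \<le> n" "1 \<le> s n" "s n \<le> n" "1 \<le> s i" "s i \<le> n"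
    using permutes_bounds[OF ps] i by auto
  have ut: "t (s n) < t (s 1)"
    using reverse_layered_last_less_first[OF ts ne(3)] i by simp
  have neq: "t x \<noteq> t y" if "x \<noteq> y" for x y
    using that permutes_inj[OF pt] by (auto dest: injD)
  have tm: "t (s n) < t (s i)" "t (s i) < t (s 1)"
    using reverse_layered_between[OF t, of "s n" "s i" "s 1"] ut i bs by auto
  have surj: "\<exists>x. 1 \<le> x \<and> x \<le> n \<and> s x = y" if "1 \<le> y" "y \<le> n" for y
  proof -
    have "y \<in> s ` {1..n}" using that permutes_image[OF ps] by simp
    then show ?thesis by auto
  qed
  \<comment> \<open>Values above \<open>s 1\<close> belong to the first layer of \<open>s\<close>,
    which ends before \<open>i\<close>; values below \<open>s n\<close> belong to the last, which
    starts after \<open>i\<close>. Within either layer \<open>s\<close> is increasing, which is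
    \<open>mono\<close>.\<close>
  have before: "x < i" if x: "1 \<le> x" "x \<le> n" "s 1 < s x" for x
    using reverse_layered_between[OF s, of 1 i x] i x by (cases x i rule: linorder_cases) auto
  have after: "i < x" if x: "1 \<le> x" "x \<le> n" "s x < s n" for x
    using reverse_layered_between[OF s, of x i n] i x by (cases x i rule: linorder_cases) auto
  have mono: "x < y" if "1 \<le> x" "x \<le> n" "1 \<le> y" "y \<le> n" "s x < s y"
      "s 1 < s x \<or> s y < s n" for x y
    using that ds[of 1 x] ds[of 1 y] ds[of x n] ds[of y n]
    by (cases "x = 1"; cases "y = 1"; cases "x = n"; cases "y = n") auto
  obtain w where w: "1 \<le> w" "w \<le> n" "s w = n" using surj[of n] i by auto
  obtain y where y: "1 \<le> y" "y \<le> n" "s y = 1" using surj[of 1] i by auto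
  consider "t 1 \<le> t (s n)" | "t (s 1) \<le> t n" | "t (s n) < t 1" "t n < t (s 1)"
    by linarith
  then show False
  proof cases
    case 1
    \<comment> \<open>The values \<open>s n\<close>, \<open>s i\<close>, \<open>s 1\<close> lie in
      the first layer of \<open>t\<close>, hence \<open>j\<close> comes after them. The preimages of
      \<open>j\<close> and \<open>n\<close> under \<open>s\<close>, followed by \<open>i\<close>,
      form a 213 in \<open>t \<circ> s\<close>.\<close>
    have "s 1 < j" using 1 tm j reverse_layered_between[OF t, of 1 j "s 1"] bs
      by (cases j "s 1" rule: linorder_cases) auto
    obtain x where x: "1 \<le> x" "x \<le> n" "s x = j" using surj[of j] j by auto
    have "x < w" using mono[of x w] x w j \<open>s 1 < j\<close> by auto
    moreover have "w < i" using before[of w] w \<open>s 1 < j\<close> j by auto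
    ultimately show False
      using reverse_layered_between[OF ts, of x w i] x w i 1 tm j by auto
  next
    case 2
    \<comment> \<open>Mirror image of the previous case: \<open>i\<close>, followed by the preimages
      of 1 and \<open>j\<close> under \<open>s\<close>, forms a 132 in
      \<open>t \<circ> s\<close>.\<close>
    have "j < s n" using 2 tm j reverse_layered_between[OF t, of "s n" j n] bs
      by (cases j "s n" rule: linorder_cases) auto
    obtain x where x: "1 \<le> x" "x \<le> n" "s x = j" using surj[of j] j by auto
    have "y < x" using mono[of y x] x y j \<open>j < s n\<close> by auto
    moreover have "i < y" using after[of y] y \<open>j < s n\<close> j by auto
    ultimately show False
      using reverse_layered_between[OF ts, of i y x] x y i 2 tm j by auto
  next
    case 3
    \<comment> \<open>Here \<open>t n < t (s 1) < t 1\<close>. Position 1 and the preimages of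
      \<open>n\<close> and 1 under \<open>s\<close>, in this order, form a 213 in
      \<open>t \<circ> s\<close>.\<close>
    have "t (s 1) < t 1"
      using 3 bs i neq[of 1 "s 1"] reverse_layered_between[OF t, of 1 "s n" "s 1"]
      by (cases "s n = 1"; cases "t 1" "t (s 1)" rule: linorder_cases) auto
    have "s 1 < n" using 3 bs by (cases "s 1 = n") auto
    have "1 < s n" using 3 bs by (cases "s n = 1") auto
    have "w < i" "i < y" using before[of w] after[of y] w y \<open>s 1 < n\<close> \<open>1 < s n\<close> by auto
    moreover have "1 < w" using w \<open>s 1 < n\<close> by (cases "w = 1") auto
    ultimately show False
      using reverse_layered_between[OF ts, of 1 w y] w y i 3 \<open>t (s 1) < t 1\<close> by auto
  qed
qed

section \<open>Rotations\<close>

text \<open>Addition of \<open>c\<close> modulo \<open>n\<close> with representatives 1 to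
  \<open>n\<close>. For \<open>0 < c < n\<close> the two branches are the two layers.\<close>

definition rotation :: "nat \<Rightarrow> nat \<Rightarrow> nat \<Rightarrow> nat" where
  "rotation n c i = (if i \<in> {1..n} then if i + c \<le> n then i + c else i + c - n else i)"

lemma permutes_natI:
  fixes n :: nat
  assumes "\<And>i. i \<in> {1..n} \<Longrightarrow> t i \<in> {1..n}" "inj_on t {1..n}" "\<And>i. i \<notin> {1..n} \<Longrightarrow> t i = i"
  shows "t permutes {1..n}"
proof (rule bij_imp_permutes)
  have "t ` {1..n} = {1..n}" using assms by (intro endo_inj_surj) auto
  then show "bij_betw t {1..n} {1..n}" using assms(2) by (simp add: bij_betw_def)
qed (use assms(3) in auto)

lemma rotation_reverse_layered:
  assumes "c \<le> n"
  shows "rotation n c \<in> reverse_layered n"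
proof -
  have "rotation n c permutes {1..n}"
    by (rule permutes_natI) (use assms in \<open>auto simp: rotation_def inj_on_def split: if_splits\<close>)
  then show ?thesis using assms by (auto simp: reverse_layered_def rotation_def)
qed

text \<open>The case split computes \<open>d - c\<close> modulo \<open>n\<close> without truncated
  subtraction. Closure under this quotient makes every pair of rotations admissible.\<close>

lemma rotation_comp_inv:
  assumes "c < n" "d < n"
  shows "rotation n d \<circ> inv (rotation n c) = rotation n (if c \<le> d then d - c else n + d - c)"
    (is "_ = rotation n ?e")
proof -
  have "rotation n d = rotation n ?e \<circ> rotation n c"
    using assms by (auto simp: fun_eq_iff rotation_def)
  moreover have "rotation n c \<circ> inv (rotation n c) = id"
    using rotation_reverse_layered[of c n] assms(1)
    by (metis less_imp_le permutes_inv_o(1) reverse_layeredD(1))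
  ultimately show ?thesis by (metis comp_assoc comp_id)
qed

lemma rotation_inj: "inj_on (rotation n) {..<n}"
proof
  fix c d assume "c \<in> {..<n}" "d \<in> {..<n}" "rotation n c = rotation n d"
  \<comment> \<open>The value at \<open>n\<close> determines the shift: it is \<open>c\<close> for
    \<open>c > 0\<close>, and \<open>n\<close> for \<open>c = 0\<close>.\<close>
  then have "rotation n c n = rotation n d n" by simp
  then show "c = d" using \<open>c \<in> {..<n}\<close> \<open>d \<in> {..<n}\<close> by (auto simp: rotation_def split: if_splits)
qed

lemma rotation_0: "rotation n 0 = id"
  by (auto simp: rotation_def)

text \<open>Without a 321 no value lies strictly between \<open>t n\<close> and \<open>t 1\<close>,
  so these are consecutive and every position is in the layer of 1 or in that of \<open>n\<close>.
  The shift is \<open>t n\<close>, the image of \<open>n\<close> under the rotation.\<close>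

lemma reverse_layered_rotation:
  assumes t: "t \<in> reverse_layered n" and "t \<noteq> id" "\<not> has_321 n t"
  obtains c where "1 \<le> c" "c < n" "t = rotation n c"
proof -
  note p = reverse_layeredD(1)[OF t] and d = reverse_layeredD(2)[OF t]
  have n: "1 \<le> n"
  proof (rule ccontr)
    assume "\<not> 1 \<le> n" then have "{1..n} = {}" by simp
    then show False using p assms(2) by simp
  qed
  have less: "t n < t 1" using reverse_layered_last_less_first[OF t assms(2) n] .
  have b: "1 \<le> t n" "t 1 \<le> n" using permutes_bounds[OF p] n by auto
  have mid: "t i < t n \<or> t 1 < t i" if "1 < i" "i < n" for i
  proof -
    have "t i \<noteq> t 1" "t i \<noteq> t n" using that permutes_inj[OF p] by (auto dest: injD)
    then show ?thesis using assms(3) that unfolding has_321_def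
      by (metis le_refl linorder_neqE_nat)
  qed
  have first: "t 1 = t n + 1"
  proof (rule ccontr)
    assume "t 1 \<noteq> t n + 1"
    then have "t n + 1 < t 1" using less by simp
    then have "t n + 1 \<in> t ` {1..n}" using b permutes_image[OF p] by simp
    then obtain x where x: "1 \<le> x" "x \<le> n" "t x = t n + 1" by auto
    then have "1 < x" "x < n" using \<open>t 1 \<noteq> t n + 1\<close> by (auto simp: order_less_le)
    then show False using mid[of x] x \<open>t n + 1 < t 1\<close> by simp
  qed
  have "t i = rotation n (t n) i" if i: "i \<in> {1..n}" for i
  proof -
    consider "i = 1" | "i = n" | "1 < i" "i < n" "t i < t n" | "1 < i" "i < n" "t 1 < t i"
      using mid[of i] i by fastforce
    then show ?thesis
      using first less b i d[of i n] d[of 1 i] permutes_bounds[OF p, of i]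
      by cases (auto simp: rotation_def)
  qed
  moreover have "t n < n" using less b by simp
  ultimately show thesis
    using that[of "t n"] b permutes_eqI[OF p reverse_layeredD(1)[OF rotation_reverse_layered]]
    by (metis less_imp_le)
qed

section \<open>Counting\<close>

text \<open>Layers descend, so the new last layer takes the lowest \<open>n - m\<close> values and
  \<open>s\<close> is lifted above it.\<close>

definition append_layer :: "nat \<Rightarrow> nat \<Rightarrow> (nat \<Rightarrow> nat) \<Rightarrow> nat \<Rightarrow> nat" where
  "append_layer n m s i = (if i \<in> {1..m} then s i + (n - m) else if i \<in> {1..n} then i - m else i)"

lemma append_layer_reverse_layered:
  assumes s: "s \<in> reverse_layered m" and "m < n"
  shows "append_layer n m s \<in> reverse_layered n"
proof -
  note p = reverse_layeredD(1)[OF s] and b = permutes_bounds[OF reverse_layeredD(1)[OF s]]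
  have "append_layer n m s permutes {1..n}"
  proof (rule permutes_natI)
    show "inj_on (append_layer n m s) {1..n}"
    proof
      fix i j assume "i \<in> {1..n}" "j \<in> {1..n}" "append_layer n m s i = append_layer n m s j"
      then show "i = j"
        using b[of i] b[of j] injD[OF permutes_inj[OF p], of i j] assms(2)
        by (auto simp: append_layer_def split: if_splits)
    qed
    fix i assume "i \<in> {1..n}"
    then show "append_layer n m s i \<in> {1..n}"
      using b[of i] assms(2) by (auto simp: append_layer_def)
  qed (use assms(2) in \<open>auto simp: append_layer_def\<close>)
  moreover have "append_layer n m s j + i = append_layer n m s i + j"
    if "1 \<le> i" "i < j" "j \<le> n" "append_layer n m s i < append_layer n m s j" for i j
  proof -
    obtain d where "n = m + d" using assms(2) less_imp_add_positive by blast
    then show ?thesis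
      using that b[of i] b[of j] reverse_layeredD(2)[OF s, of i j] assms(2)
      by (auto simp: append_layer_def split: if_splits)
  qed
  ultimately show ?thesis by (auto simp: reverse_layered_def)
qed

lemma append_layer_inj: "inj_on (append_layer n m) (reverse_layered m)"
proof
  fix s t assume st: "s \<in> reverse_layered m" "t \<in> reverse_layered m"
    and eq: "append_layer n m s = append_layer n m t"
  have "s i = t i" if "i \<in> {1..m}" for i
    using fun_cong[OF eq, of i] that by (auto simp: append_layer_def)
  then show "s = t" using st by (blast intro: permutes_eqI dest: reverse_layeredD(1))
qed

text \<open>The lift by \<open>n - m > 0\<close> keeps the value 1 out of the first \<open>m\<close>
  positions. So \<open>m\<close> can be read off, which makes the union in the recursion
  disjoint.\<close>

lemma append_layer_preimage_1:
  assumes "s \<in> reverse_layered m" "m < n" "1 \<le> i" "i \<le> n" "append_layer n m s i = 1"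
  shows "i = Suc m"
  using assms(2-) permutes_bounds[OF reverse_layeredD(1)[OF assms(1)], of i]
  by (auto simp: append_layer_def split: if_splits)

lemma reverse_layered_obtain_last_layer:
  assumes t: "t \<in> reverse_layered n" and "1 \<le> n"
  obtains m s where "m < n" "s \<in> reverse_layered m" "t = append_layer n m s"
proof -
  note p = reverse_layeredD(1)[OF t] and d = reverse_layeredD(2)[OF t]
  have "1 \<in> t ` {1..n}" using permutes_image[OF p] assms(2) by simp
  then obtain y where y: "1 \<le> y" "y \<le> n" "t y = 1" by auto
  \<comment> \<open>The last layer holds the smallest values and therefore starts at the position
    \<open>y\<close> of the value 1.\<close>
  define m where "m = y - 1"
  have m: "m < n" "y = Suc m" using y by (auto simp: m_def)
  note b = permutes_bounds[OF p] and neq = injD[OF permutes_inj[OF p]]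
  have hi: "t i = i - m" if "m < i" "i \<le> n" for i
    using that d[of y i] b[of i] neq[of i y] y m by (cases "i = y"; cases "t i = 1") auto
  \<comment> \<open>If \<open>t i < t n = n - m\<close>, slope one would give
    \<open>t i + m = i \<le> m\<close>, contradicting \<open>t i \<ge> 1\<close>.\<close>
  have lo: "n - m < t i" if "1 \<le> i" "i \<le> m" for i
  proof -
    have "t i \<noteq> t n" using neq[of i n] that m by auto
    then show ?thesis using that d[of i n] hi[of n] b[of i] m by (cases "t i < t n") auto
  qed
  define s where "s i = (if i \<in> {1..m} then t i - (n - m) else i)" for i
  have "s permutes {1..m}"
  proof (rule permutes_natI)
    show "inj_on s {1..m}"
    proof
      fix i j assume "i \<in> {1..m}" "j \<in> {1..m}" "s i = s j"
      then show "i = j" using lo[of i] lo[of j] neq[of i j] by (auto simp: s_def)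
    qed
    fix i assume "i \<in> {1..m}"
    then show "s i \<in> {1..m}" using lo[of i] b[of i] m by (auto simp: s_def)
  qed (auto simp: s_def)
  moreover have "s j + i = s i + j" if ij: "1 \<le> i" "i < j" "j \<le> m" "s i < s j" for i j
  proof -
    have eq: "t i = s i + (n - m)" "t j = s j + (n - m)"
      using ij lo[of i] lo[of j] by (auto simp: s_def)
    then have "t j + i = t i + j" using ij d[of i j] m by linarith
    then show ?thesis using eq by linarith
  qed
  ultimately have s: "s \<in> reverse_layered m" by (auto simp: reverse_layered_def)
  have "t = append_layer n m s"
  proof (rule permutes_eqI[OF p reverse_layeredD(1)[OF append_layer_reverse_layered[OF s m(1)]]])
    fix i assume "i \<in> {1..n}"
    then show "t i = append_layer n m s i"
      using hi[of i] lo[of i] by (auto simp: append_layer_def s_def)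
  qed
  with m s show thesis by (intro that)
qed

lemma card_reverse_layered_rec:
  assumes "1 \<le> n"
  shows "card (reverse_layered n) = (\<Sum>m<n. card (reverse_layered m))"
proof -
  have "reverse_layered n = (\<Union>m\<in>{..<n}. append_layer n m ` reverse_layered m)"
  proof (intro equalityI subsetI)
    fix t assume "t \<in> reverse_layered n"
    from reverse_layered_obtain_last_layer[OF this assms]
    show "t \<in> (\<Union>m\<in>{..<n}. append_layer n m ` reverse_layered m)" by blast
  qed (auto intro: append_layer_reverse_layered)
  also have "card \<dots> = (\<Sum>m<n. card (append_layer n m ` reverse_layered m))"
  proof (rule card_UN_disjoint)
    have "m = k" if "m < n" "k < n" "s \<in> reverse_layered m" "t \<in> reverse_layered k"
      "append_layer n m s = append_layer n k t" for m k s t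
    proof -
      have "append_layer n m s (Suc m) = 1" using that(1) by (simp add: append_layer_def)
      then show ?thesis using append_layer_preimage_1[of t k n "Suc m"] that by simp
    qed
    then show "\<forall>m\<in>{..<n}. \<forall>k\<in>{..<n}. m \<noteq> k \<longrightarrow>
        append_layer n m ` reverse_layered m \<inter> append_layer n k ` reverse_layered k = {}"
      by blast
  qed (auto simp: finite_reverse_layered)
  also have "\<dots> = (\<Sum>m<n. card (reverse_layered m))"
    by (simp add: card_image append_layer_inj)
  finally show ?thesis .
qed

text \<open>Consecutive sums in the recursion differ by one term equal to the earlier sum, so the
  count doubles. Doubling starts at size 1, since sizes 0 and 1 both have one member.\<close>

lemma card_reverse_layered: "card (reverse_layered (Suc n)) = 2 ^ n"
proof (induction n)
  case 0
  have "reverse_layered 0 = {id}" by (auto simp: reverse_layered_def)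
  then show ?case using card_reverse_layered_rec[of 1] by simp
next
  case (Suc n)
  have "card (reverse_layered (Suc (Suc n))) = card (reverse_layered (Suc n)) + card (reverse_layered (Suc n))"
    using card_reverse_layered_rec[of "Suc n"] card_reverse_layered_rec[of "Suc (Suc n)"] by simp
  then show ?case using Suc by simp
qed

section \<open>Counting the pairs\<close>

lemma avoiding_eq_reverse_layered_pairs:
  "avoiding_three_permutations n {[1, 3, 2], [2, 1, 3]} =
     {(s, s'). s \<in> reverse_layered n \<and> s' \<in> reverse_layered n \<and> s' \<circ> inv s \<in> reverse_layered n}"
proof -
  have "(s, s') \<in> avoiding_three_permutations n {[1, 3, 2], [2, 1, 3]} \<longleftrightarrow>
      s \<in> reverse_layered n \<and> s' \<in> reverse_layered n \<and> s' \<circ> inv s \<in> reverse_layered n" for s s'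
  proof (cases "s permutes {1..n} \<and> s' permutes {1..n}")
    case True
    then have "s' \<circ> inv s permutes {1..n}" by (intro permutes_compose permutes_inv) auto
    with True show ?thesis
      unfolding avoiding_three_permutations_def three_permutations_def
      by (simp add: avoids_iff_reverse_layered[symmetric] del: One_nat_def) blast
  next
    case False
    then show ?thesis using reverse_layeredD(1)[of _ n]
      unfolding avoiding_three_permutations_def three_permutations_def by blast
  qed
  then show ?thesis by auto
qed

lemma reverse_layered_pairs_eq:
  fixes n :: nat
  defines "A \<equiv> reverse_layered n - {id}"
  shows "{(s, s'). s \<in> reverse_layered n \<and> s' \<in> reverse_layered n \<and> s' \<circ> inv s \<in> reverse_layered n} =
     {(id, id)} \<union> {id} \<times> A \<union> A \<times> {id} \<union> (\<lambda>s. (s, s)) ` A \<union>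
     map_prod (rotation n) (rotation n) ` ({1..<n} \<times> {1..<n} - (\<lambda>c. (c, c)) ` {1..<n})"
    (is "?L = ?R")
proof (intro equalityI subsetI)
  fix x assume "x \<in> ?L"
  then obtain s s' where x: "x = (s, s')" and s: "s \<in> reverse_layered n" and s': "s' \<in> reverse_layered n"
    and t: "s' \<circ> inv s \<in> reverse_layered n" by auto
  show "x \<in> ?R"
  proof (cases "s = id \<or> s' = id \<or> s = s'")
    case True
    then show ?thesis using x s s' by (auto simp: A_def)
  next
    case False
    note p = reverse_layeredD(1)[OF s] and p' = reverse_layeredD(1)[OF s']
    \<comment> \<open>\<open>not_has_321\<close> excludes 321 only from the inner factor, so it is
      used twice: with product \<open>s'\<close> for \<open>s\<close>, and with product
      \<open>s\<close> for \<open>s'\<close>.\<close>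
    have comp: "s' \<circ> inv s \<circ> s = s'" "s \<circ> inv s' = inv (s' \<circ> inv s)" "s \<circ> inv s' \<circ> s' = s"
      using permutes_inv_o[OF p] permutes_inv_o[OF p']
      by (simp_all add: comp_assoc o_inv_distrib permutes_bij[OF p] permutes_bij[OF p']
            permutes_bij[OF permutes_inv[OF p]] inv_inv_eq)
    have t': "s \<circ> inv s' \<in> reverse_layered n" using inv_reverse_layered[OF t] comp by simp
    have ne: "s' \<circ> inv s \<noteq> id" "s \<circ> inv s' \<noteq> id" using False comp by (metis id_comp)+
    obtain c where c: "1 \<le> c" "c < n" "s = rotation n c"
      using reverse_layered_rotation[OF s] not_has_321[OF s t] False ne s' comp by metis
    obtain d where d: "1 \<le> d" "d < n" "s' = rotation n d"
      using reverse_layered_rotation[OF s'] not_has_321[OF s' t'] False ne s comp by metis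
    have "(c, d) \<in> {1..<n} \<times> {1..<n} - (\<lambda>c. (c, c)) ` {1..<n}" using False c d by auto
    then show ?thesis using x c d by (intro UnI2 image_eqI[of _ _ "(c, d)"]) auto
  qed
next
  have inv: "s \<circ> inv s = id" if "s \<in> reverse_layered n" for s
    using that by (blast intro: permutes_inv_o dest: reverse_layeredD(1))
  have rot: "rotation n c \<in> reverse_layered n" "rotation n d \<in> reverse_layered n"
      "rotation n d \<circ> inv (rotation n c) \<in> reverse_layered n" if "c < n" "d < n" for c d
    using that by (auto simp: rotation_comp_inv intro!: rotation_reverse_layered)
  fix x assume "x \<in> ?R"
  then show "x \<in> ?L"
  proof (elim UnE)
    assume "x \<in> map_prod (rotation n) (rotation n) ` ({1..<n} \<times> {1..<n} - (\<lambda>c. (c, c)) ` {1..<n})"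
    then obtain c d where "x = (rotation n c, rotation n d)" "c < n" "d < n" by auto
    then show ?thesis using rot[of c d] by simp
  qed (auto simp: A_def inv inv_id inv_reverse_layered id_reverse_layered)
qed

lemma card_pairs_Un:
  assumes "finite A" "finite M" "e \<notin> A" "\<And>s s'. (s, s') \<in> M \<Longrightarrow> s \<noteq> e \<and> s' \<noteq> e \<and> s \<noteq> s'"
  shows "card ({(e, e)} \<union> {e} \<times> A \<union> A \<times> {e} \<union> (\<lambda>s. (s, s)) ` A \<union> M) = 1 + 3 * card A + card M"
proof -
  have "card ({(e, e)} \<union> {e} \<times> A \<union> A \<times> {e} \<union> (\<lambda>s. (s, s)) ` A \<union> M) =
      card {(e, e)} + card ({e} \<times> A) + card (A \<times> {e}) + card ((\<lambda>s. (s, s)) ` A) + card M"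
  proof (subst card_Un_disjoint)
    show "({(e, e)} \<union> {e} \<times> A \<union> A \<times> {e} \<union> (\<lambda>s. (s, s)) ` A) \<inter> M = {}"
      using assms(4) by blast
    show "card ({(e, e)} \<union> {e} \<times> A \<union> A \<times> {e} \<union> (\<lambda>s. (s, s)) ` A) + card M =
        card {(e, e)} + card ({e} \<times> A) + card (A \<times> {e}) + card ((\<lambda>s. (s, s)) ` A) + card M"
      using assms(1,3) by (subst card_Un_disjoint; (blast | simp))+
  qed (use assms(1,2) in auto)
  then show ?thesis by (simp add: card_cartesian_product card_image inj_on_def)
qed

text \<open>The degenerate pairs number \<open>1 + 3 * (2 ^ n - 1)\<close>, and ordered pairs of
  distinct shifts from 1 to \<open>n\<close> give \<open>n * (n - 1)\<close>. The summand 2 on the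
  left avoids a subtraction.\<close>

lemma card_avoiding:
  "card (avoiding_three_permutations (Suc n) {[1, 3, 2], [2, 1, 3]}) + 2 = 3 * 2 ^ n + n * (n - 1)"
proof -
  define N where "N = Suc n"
  define A where "A = reverse_layered N - {id}"
  define P where "P = {1..<N} \<times> {1..<N} - (\<lambda>c. (c, c)) ` {1..<N}"
  let ?M = "map_prod (rotation N) (rotation N) ` P"
  have fin: "finite A" "finite P" by (auto simp: A_def P_def finite_reverse_layered)
  have A: "card A = 2 ^ n - 1"
    by (simp add: A_def N_def card_reverse_layered id_reverse_layered finite_reverse_layered)
  have P: "card P = n * (n - 1)"
  proof -
    have "card P = card ({1..<N} \<times> {1..<N}) - card ((\<lambda>c. (c, c)) ` {1..<N})"
      unfolding P_def by (rule card_Diff_subset) auto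
    then show ?thesis
      by (simp add: N_def card_image inj_on_def card_cartesian_product diff_mult_distrib2)
  qed
  have inj: "inj_on (map_prod (rotation N) (rotation N)) P"
    by (rule inj_on_subset[OF map_prod_inj_on[OF rotation_inj rotation_inj]]) (auto simp: P_def)
  have M: "s \<noteq> id" "s' \<noteq> id" "s \<noteq> s'" if ss': "(s, s') \<in> ?M" for s s'
  proof -
    obtain c d where cd: "(c, d) \<in> P" "s = rotation N c" "s' = rotation N d" using ss' by auto
    have "c \<in> {..<N}" "d \<in> {..<N}" "0 \<in> {..<N}" "c \<noteq> 0" "d \<noteq> 0" "c \<noteq> d"
      using cd(1) by (auto simp: P_def N_def)
    then show "s \<noteq> id" "s' \<noteq> id" "s \<noteq> s'"
      using cd inj_onD[OF rotation_inj[of N], of c 0] inj_onD[OF rotation_inj[of N], of d 0]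
        inj_onD[OF rotation_inj[of N], of c d] by (auto simp: rotation_0)
  qed
  have "card (avoiding_three_permutations N {[1, 3, 2], [2, 1, 3]}) =
      card ({(id, id)} \<union> {id} \<times> A \<union> A \<times> {id} \<union> (\<lambda>s. (s, s)) ` A \<union> ?M)"
    unfolding avoiding_eq_reverse_layered_pairs reverse_layered_pairs_eq A_def P_def ..
  also have "\<dots> = 1 + 3 * card A + card ?M"
    using fin M by (intro card_pairs_Un) (auto simp: A_def)
  also have "\<dots> = 1 + 3 * (2 ^ n - 1) + n * (n - 1)"
    by (simp add: A P card_image[OF inj])
  finally show ?thesis using one_le_power[of "2::nat" n] unfolding N_def by linarith
qed

theorem theorem3p7:
  fixes a :: "nat \<Rightarrow> nat"
  assumes "\<And>n. n \<ge> 1 \<Longrightarrow> a n = card (avoiding_three_permutations n {[1, 3, 2], [2, 1, 3]})"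
  shows "a 1 = 1 \<and> (\<forall>n\<ge>1. a (n + 1) = a n + 3 * 2 ^ (n - 1) + 2 * (n - 1))"
proof -
  have a: "a (Suc k) + 2 = 3 * 2 ^ k + k * (k - 1)" for k
    using assms[of "Suc k"] card_avoiding[of k] by simp
  have "a (n + 1) = a n + 3 * 2 ^ (n - 1) + 2 * (n - 1)" if n: "n \<ge> 1" for n
  proof -
    obtain k where k: "n = Suc k" using n by (cases n) auto
    \<comment> \<open>The products differ by \<open>(k + 1) * k - k * (k - 1) = 2 * k\<close>; the
      case \<open>k = 0\<close> is separate because \<open>k - 1\<close> truncates there.\<close>
    show ?thesis using a[of k] a[of "Suc k"] unfolding k by (cases k) auto
  qed
  then show ?thesis using a[of 0] by auto
qed

end
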